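(* Let $c_1,\dots,c_6,d_1,d_2,d_3$ be real numbers with $d_2\ne 0$, and let $\lambda,\mu$, $a_1,\dots,a_6$, $b_1,\dots,b_6$ be complex numbers chosen as follows. - $\lambda$ is a root of the equation $x+\frac1x=\frac{d_1}{d_2}$. - $\mu$ is a root of the equation $$\begin{aligned} &\sqrt{c_2-c_3+\mu^2(c_5-c_6)}\,\sqrt{c_3-c_1+\mu^2(c_6-c_4)}\,\Bigl(d_3-\tfrac{d_2}{\lambda}(c_1+\lambda^2c_4)\Bigr)\bigl(c_2-c_3+\lambda^2(c_5-c_6)\bigr)\\ &+\bigl(c_1-c_3+\lambda^2(c_4-c_6)\bigr)\Bigl(\tfrac{d_2}{\lambda}(c_2+\lambda^2c_5)-d_3\Bigr)\bigl(c_1-c_2+\lambda\mu(c_4-c_5)\bigr)\\ &+\sqrt{c_2-c_3+\mu^2(c_5-c_6)}\,\sqrt{c_1-c_2+\mu^2(c_4-c_5)}\,\Bigl(\tfrac{d_2}{\lambda}(c_2+\lambda^2c_5)-d_3\Bigr)\bigl(c_1-c_3+\lambda\mu(c_4-c_6)\bigr)\\ &+\sqrt{c_3-c_1+\mu^2(c_6-c_4)}\,\sqrt{c_1-c_2+\mu^2(c_4-c_5)}\,\Bigl(d_3-\tfrac{d_2}{\lambda}(c_1+\lambda^2c_4)\Bigr)\bigl(c_2-c_3+\lambda\mu(c_5-c_6)\bigr)=0 . \end{aligned}$$ - $b_1=\sqrt{c_2-c_3+\mu^2(c_5-c_6)}$, $b_2=\sqrt{c_3-c_1+\mu^2(c_6-c_4)}$,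 $b_3=\sqrt{c_1-c_2+\mu^2(c_4-c_5)}$ (the same values of the square roots as in the equation for $\mu$), and $b_4=\mu b_1$, $b_5=\mu b_2$, $b_6=\mu b_3$. - $a_4=\lambda a_1$, $a_5=\lambda a_2$, $a_6=\lambda a_3$, where $a_1,a_2,a_3$ are such that the line $x_i=a_i+tb_i$ ($i=1,\dots,6$, $t\in\mathbb{C}$) lies in $$\{x\in\mathbb{C}^6:\ f_1(x)=d_1,\ f_2(x)=d_2,\ f_3(x)=d_3\},$$ with $f_1(x)=\sum_{i=1}^6x_i^2$, $f_2(x)=x_1x_4+x_2x_5+x_3x_6$, $f_3(x)=\sum_{i=1}^6c_ix_i^2$. Suppose that: 1. $\frac{d_2}{\lambda}(c_2+\lambda^2c_5)-d_3\neq 0$; 2. the equalities $c_1=c_2$ and $c_4=c_5$ do not both hold; 3. the equalities $c_1=c_3$ and $c_4=c_6$ do not both hold; 4. the equation for $\mu$ has a root different from $\lambda$ and from $-\lambda$, and $\mu$ is such a root; 5. not all of the numbers $a_1,a_2,a_3$ are real. Then for every complex number $t$ the six numbers $a_j+tb_j$, $j=1,\dots,6$, cannot all be real simultaneously.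
   Context: The parameters $c_i,d_j$ are real. Each square root denotes a fixed complex square root of the indicated number, used consistently in the equation for $\mu$ and in the definition of $b_1,b_2,b_3$. *)

theory Defs
  imports "HOL-Analysis.Analysis"
begin

text \<open>
  Vectors with six coordinates are indexed by the type \<open>6\<close>, whose elements are
  \<open>1, 2, 3, 4, 5\<close> and \<open>6 = 0\<close>.
\<close>

definition f1 :: "complex ^ 6 \<Rightarrow> complex" where
  "f1 x = (\<Sum>i\<in>UNIV. (x $ i)\<^sup>2)"

definition f2 :: "complex ^ 6 \<Rightarrow> complex" where
  "f2 x = x $ 1 * x $ 4 + x $ 2 * x $ 5 + x $ 3 * x $ 6"

definition f3 :: "real ^ 6 \<Rightarrow> complex ^ 6 \<Rightarrow> complex" where
  "f3 c x = (\<Sum>i\<in>UNIV. of_real (c $ i) * (x $ i)\<^sup>2)"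

definition level_set :: "real ^ 6 \<Rightarrow> real \<Rightarrow> real \<Rightarrow> real \<Rightarrow> (complex ^ 6) set" where
  "level_set c d1 d2 d3 =
     {x. f1 x = of_real d1 \<and> f2 x = of_real d2 \<and> f3 c x = of_real d3}"

definition complex_line :: "complex ^ 6 \<Rightarrow> complex ^ 6 \<Rightarrow> (complex ^ 6) set" where
  "complex_line a b = range (\<lambda>t. a + t *s b)"

text \<open>The explicit \<open>x \<noteq> 0\<close> is needed because \<open>1 / 0 = 0\<close> in HOL.\<close>

definition lambda_root :: "real \<Rightarrow> real \<Rightarrow> complex \<Rightarrow> bool" where
  "lambda_root d1 d2 x \<longleftrightarrow> x \<noteq> 0 \<and> x + 1 / x = of_real d1 / of_real d2"

definition radicand1 :: "real ^ 6 \<Rightarrow> complex \<Rightarrow> complex" where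
  "radicand1 c mu = of_real (c$2) - of_real (c$3) + mu\<^sup>2 * (of_real (c$5) - of_real (c$6))"

definition radicand2 :: "real ^ 6 \<Rightarrow> complex \<Rightarrow> complex" where
  "radicand2 c mu = of_real (c$3) - of_real (c$1) + mu\<^sup>2 * (of_real (c$6) - of_real (c$4))"

definition radicand3 :: "real ^ 6 \<Rightarrow> complex \<Rightarrow> complex" where
  "radicand3 c mu = of_real (c$1) - of_real (c$2) + mu\<^sup>2 * (of_real (c$4) - of_real (c$5))"

text \<open>
  The equation for \<open>mu\<close>, where \<open>s1, s2, s3\<close> are the chosen values of the square roots
  of the radicands at \<open>mu\<close>. No branch of the square root is singled out: each sign is free.
\<close>

definition mu_root ::
  "real ^ 6 \<Rightarrow> real \<Rightarrow> real \<Rightarrow> complex \<Rightarrow> complex \<Rightarrow> complex \<Rightarrow> complex \<Rightarrow> complex \<Rightarrow> bool" where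
  "mu_root c d2 d3 lam s1 s2 s3 mu \<longleftrightarrow>
     s1\<^sup>2 = radicand1 c mu \<and> s2\<^sup>2 = radicand2 c mu \<and> s3\<^sup>2 = radicand3 c mu \<and>
     s1 * s2 * (of_real d3 - of_real d2 / lam * (of_real (c$1) + lam\<^sup>2 * of_real (c$4)))
       * (of_real (c$2) - of_real (c$3) + lam\<^sup>2 * (of_real (c$5) - of_real (c$6)))
     + (of_real (c$1) - of_real (c$3) + lam\<^sup>2 * (of_real (c$4) - of_real (c$6)))
       * (of_real d2 / lam * (of_real (c$2) + lam\<^sup>2 * of_real (c$5)) - of_real d3)
       * (of_real (c$1) - of_real (c$2) + lam * mu * (of_real (c$4) - of_real (c$5)))
     + s1 * s3 * (of_real d2 / lam * (of_real (c$2) + lam\<^sup>2 * of_real (c$5)) - of_real d3)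
       * (of_real (c$1) - of_real (c$3) + lam * mu * (of_real (c$4) - of_real (c$6)))
     + s2 * s3 * (of_real d3 - of_real d2 / lam * (of_real (c$1) + lam\<^sup>2 * of_real (c$4)))
       * (of_real (c$2) - of_real (c$3) + lam * mu * (of_real (c$5) - of_real (c$6)))
     = 0"

end

(* Write p and q for the first and last three coordinates of a point of the line. The radicands sum
   to zero, so (b1,b2,b3) is isotropic; comparing f2 at t = 0 and t = 1 and using mu \<noteq> -lam makes it
   orthogonal to (a1,a2,a3). Hence p.p = a.a = d2/lam. If p and q are real, then so is lam, and
   q - lam p = t (mu - lam) (b1,b2,b3) is a real isotropic vector, hence zero. As mu \<noteq> lam, this
   forces p = (a1,a2,a3), which is then real. *)

theory Submission
  imports Defs
begin

text \<open>Over the complex numbers nonzero isotropic vectors exist, for instance (1, i, 0). Real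
  entries rule them out by positivity, so the equation is pulled back along
  \<open>of_real\<close>.\<close>

lemma sum3_squares_eq_0_Reals:
  fixes u v w :: "'a :: real_algebra_1"
  assumes "u \<in> \<real>" "v \<in> \<real>" "w \<in> \<real>" and "u\<^sup>2 + v\<^sup>2 + w\<^sup>2 = 0"
  shows "u = 0 \<and> v = 0 \<and> w = 0"
proof -
  obtain x y z :: real where xyz: "u = of_real x" "v = of_real y" "w = of_real z"
    using assms(1-3) by (auto elim!: Reals_cases)
  have "(of_real (x\<^sup>2 + y\<^sup>2 + z\<^sup>2) :: 'a) = 0"
    using assms(4) xyz by simp
  hence "x\<^sup>2 + y\<^sup>2 + z\<^sup>2 = 0"
    by (simp only: of_real_eq_0_iff)
  thus ?thesis
    using xyz by (simp add: add_nonneg_eq_0_iff)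
qed

theorem mainTheorem3:
  fixes c :: "real ^ 6" and d1 d2 d3 :: real
    and lam mu s1 s2 s3 :: complex and a b :: "complex ^ 6"
  assumes d2: "d2 \<noteq> 0"
    and lambda: "lambda_root d1 d2 lam"
    and mu_eq: "mu_root c d2 d3 lam s1 s2 s3 mu"
    and b123: "b $ 1 = s1" "b $ 2 = s2" "b $ 3 = s3"
    and b456: "b $ 4 = mu * b $ 1" "b $ 5 = mu * b $ 2" "b $ 6 = mu * b $ 3"
    and a456: "a $ 4 = lam * a $ 1" "a $ 5 = lam * a $ 2" "a $ 6 = lam * a $ 3"
    and line: "complex_line a b \<subseteq> level_set c d1 d2 d3"
    and h1: "of_real d2 / lam * (of_real (c $ 2) + lam\<^sup>2 * of_real (c $ 5)) - of_real d3 \<noteq> 0"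
    and h2: "\<not> (c $ 1 = c $ 2 \<and> c $ 4 = c $ 5)"
    and h3: "\<not> (c $ 1 = c $ 3 \<and> c $ 4 = c $ 6)"
    and h4: "mu \<noteq> lam" "mu \<noteq> - lam"
    and h5: "\<not> (a $ 1 \<in> \<real> \<and> a $ 2 \<in> \<real> \<and> a $ 3 \<in> \<real>)"
  shows "\<forall>t :: complex. \<not> (\<forall>j. a $ j + t * b $ j \<in> \<real>)"
proof (intro allI notI)
  fix t :: complex
  assume real: "\<forall>j. a $ j + t * b $ j \<in> \<real>"
  have isotropic: "(b $ 1)\<^sup>2 + (b $ 2)\<^sup>2 + (b $ 3)\<^sup>2 = 0"
  proof -
    have roots: "s1\<^sup>2 = radicand1 c mu" "s2\<^sup>2 = radicand2 c mu" "s3\<^sup>2 = radicand3 c mu"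
      using mu_eq by (simp_all add: mu_root_def)
    show ?thesis
      unfolding b123 roots by (simp add: radicand1_def radicand2_def radicand3_def algebra_simps)
  qed
  have f2_line: "f2 (a + s *s b) = d2" for s
    using line by (auto simp: complex_line_def level_set_def)
  have aa: "lam * ((a $ 1)\<^sup>2 + (a $ 2)\<^sup>2 + (a $ 3)\<^sup>2) = d2"
    using f2_line[of 0] by (simp add: f2_def a456 power2_eq_square algebra_simps)
  \<comment> \<open>Along the line \<open>f2\<close> is a quadratic polynomial in \<open>s\<close>;
    the three summands are its coefficients, added up at \<open>s = 1\<close>. The constant one
    equals \<open>d2\<close> and the leading one vanishes by isotropy.\<close>
  have "lam * ((a $ 1)\<^sup>2 + (a $ 2)\<^sup>2 + (a $ 3)\<^sup>2)
      + (lam + mu) * (a $ 1 * b $ 1 + a $ 2 * b $ 2 + a $ 3 * b $ 3)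
      + mu * ((b $ 1)\<^sup>2 + (b $ 2)\<^sup>2 + (b $ 3)\<^sup>2) = d2"
    using f2_line[of 1] by (simp add: f2_def a456 b456 power2_eq_square algebra_simps)
  hence "(lam + mu) * (a $ 1 * b $ 1 + a $ 2 * b $ 2 + a $ 3 * b $ 3) = 0"
    using aa isotropic by simp
  hence orthogonal: "a $ 1 * b $ 1 + a $ 2 * b $ 2 + a $ 3 * b $ 3 = 0"
    using h4(2) by (simp add: add_eq_0_iff)
  define P where "P = (a $ 1 + t * b $ 1)\<^sup>2 + (a $ 2 + t * b $ 2)\<^sup>2 + (a $ 3 + t * b $ 3)\<^sup>2"
  have "P = (a $ 1)\<^sup>2 + (a $ 2)\<^sup>2 + (a $ 3)\<^sup>2
      + 2 * t * (a $ 1 * b $ 1 + a $ 2 * b $ 2 + a $ 3 * b $ 3)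
      + t\<^sup>2 * ((b $ 1)\<^sup>2 + (b $ 2)\<^sup>2 + (b $ 3)\<^sup>2)"
    by (simp add: P_def power2_eq_square algebra_simps)
  hence "lam * P = d2"
    using isotropic orthogonal aa by simp
  \<comment> \<open>Since \<open>d2\<close> is nonzero, so is \<open>P\<close>, and the division is
    genuine.\<close>
  hence "lam = d2 / P"
    using d2 by (metis mult_zero_right nonzero_eq_divide_eq of_real_eq_0_iff)
  moreover have "P \<in> \<real>"
    unfolding P_def by (intro Reals_add[OF Reals_add] Reals_power real[rule_format])
  ultimately have lam_real: "lam \<in> \<real>"
    by (auto intro: Reals_divide)
  have "(a $ 4 + t * b $ 4) - lam * (a $ 1 + t * b $ 1) \<in> \<real>"
       "(a $ 5 + t * b $ 5) - lam * (a $ 2 + t * b $ 2) \<in> \<real>"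
       "(a $ 6 + t * b $ 6) - lam * (a $ 3 + t * b $ 3) \<in> \<real>"
    by (intro Reals_diff Reals_mult lam_real real[rule_format])+
  \<comment> \<open>The terms in \<open>a\<close> cancel because its last three coordinates are
    \<open>lam\<close> times the first three.\<close>
  hence "t * (mu - lam) * b $ 1 \<in> \<real>" "t * (mu - lam) * b $ 2 \<in> \<real>" "t * (mu - lam) * b $ 3 \<in> \<real>"
    by (simp_all add: a456 b456 algebra_simps)
  moreover have "(t * (mu - lam) * b $ 1)\<^sup>2 + (t * (mu - lam) * b $ 2)\<^sup>2
      + (t * (mu - lam) * b $ 3)\<^sup>2 = 0"
    using isotropic by (simp add: power_mult_distrib flip: distrib_left)
  ultimately have "t * (mu - lam) * b $ 1 = 0 \<and> t * (mu - lam) * b $ 2 = 0 \<and> t * (mu - lam) * b $ 3 = 0"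
    by (rule sum3_squares_eq_0_Reals)
  \<comment> \<open>Only \<open>mu - lam\<close> is cancelled: either \<open>t\<close> or the
    entries of \<open>b\<close> may vanish, and in both cases the point has the same first three
    coordinates as \<open>a\<close>.\<close>
  hence "t * b $ 1 = 0" "t * b $ 2 = 0" "t * b $ 3 = 0"
    using h4(1) by auto
  hence "a $ 1 \<in> \<real> \<and> a $ 2 \<in> \<real> \<and> a $ 3 \<in> \<real>"
    using real by (metis add.right_neutral)
  with h5 show False
    by contradiction
qed

end
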